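(* Let $s_1,\ldots,s_m\in\mathbb{N}^*$ be a tuple of integers with $\gcd(s_1,\ldots,s_m)=1$. Then $$L(s_1,\ldots,s_m)\le\min_{\sigma\in S_m}\left\{\sum_{i=1}^{m-1}\left\lceil\log_2\left(\frac{\sum_{j=i}^m s_{\sigma(j)}}{\gcd\left(\sum_{j=i}^m s_{\sigma(j)},\,s_{\sigma(i)}\right)}\right)\right\rceil\right\},$$ where $S_m$ is the symmetric group on $\{1,\ldots,m\}$.
   Context: $\mathbb{N}^*$ is the set of positive integers; $\lceil a\rceil$ is the least integer not smaller than $a$. For integers $s_1,\ldots,s_m$ put $\hat{s}=\sum_{i=1}^m s_i$. A simple second-order cone representation of size $n\ge 1$ of the weighted geometric mean inequality $x_1^{s_1}\cdots x_m^{s_m}\ge x_{m+1}^{\hat{s}}$ is a set of $n$ quadratic inequalities $x_{i_k}x_{j_k}\ge x_{m+k}^2$, $k=1,\ldots,n$, with $i_k,j_k\in\{1,2,\ldots,m+n\}$, such that for all nonnegative reals $x_1,\ldots,x_{m+1}$: $x_1^{s_1}\cdots x_m^{s_m}\ge x_{m+1}^{\hat{s}}$ holds if and only if there exist nonnegative reals $x_{m+2},\ldots,x_{m+n}$ (the $n-1$ auxiliary variables) with $x_{i_k}x_{j_k}\ge x_{m+k}^2$ for all $k=1,\ldots,n$. $L(s_1,\ldots,s_m)$ denotes the minimum size $n$ of a simple second-order cone representation of $x_1^{s_1}\cdots x_m^{s_m}\ge x_{m+1}^{\hat{s}}$.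
   Formalization: The formal statement assumes m ≥ 2; for m = 1 the gcd condition forces s_1 = 1, the right-hand side is an empty sum equal to 0, while every representation has size n ≥ 1 (L(1) = 1), so the claim fails there. *)

theory Defs
  imports Complex_Main "HOL-Library.Extended_Nat" "HOL-Combinatorics.Permutations"
begin

text \<open>
  Finite tuples \<open>s\<^sub>1, \<dots>, s\<^sub>m\<close> and \<open>x\<^sub>1, \<dots>, x\<^bsub>m+n\<^esub>\<close> are functions on \<^typ>\<open>nat\<close>
  of which only the values at the indices \<open>1, 2, \<dots>\<close> in range matter.
\<close>

definition weighted_gm_ineq :: "nat \<Rightarrow> (nat \<Rightarrow> nat) \<Rightarrow> (nat \<Rightarrow> real) \<Rightarrow> bool" where
  "weighted_gm_ineq m s x \<longleftrightarrow> (\<Prod>l=1..m. x l ^ s l) \<ge> x (m + 1) ^ (\<Sum>l=1..m. s l)"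

text \<open>
  The \<open>n\<close> quadratic inequalities are given by the index functions \<open>i\<close> and \<open>j\<close>.
  The existentially quantified \<open>y\<close> extends the given point \<open>x\<^sub>1, \<dots>, x\<^bsub>m+1\<^esub>\<close>
  by the \<open>n - 1\<close> auxiliary variables.
\<close>

definition simple_soc_representation ::
    "nat \<Rightarrow> (nat \<Rightarrow> nat) \<Rightarrow> nat \<Rightarrow> (nat \<Rightarrow> nat) \<Rightarrow> (nat \<Rightarrow> nat) \<Rightarrow> bool" where
  "simple_soc_representation m s n i j \<longleftrightarrow>
     n \<ge> 1 \<and>
     (\<forall>k\<in>{1..n}. i k \<in> {1..m + n} \<and> j k \<in> {1..m + n}) \<and>
     (\<forall>x :: nat \<Rightarrow> real. (\<forall>l\<in>{1..m + 1}. 0 \<le> x l) \<longrightarrow>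
        (weighted_gm_ineq m s x \<longleftrightarrow>
          (\<exists>y :: nat \<Rightarrow> real.
             (\<forall>l\<in>{1..m + 1}. y l = x l) \<and>
             (\<forall>l\<in>{m + 2..m + n}. 0 \<le> y l) \<and>
             (\<forall>k\<in>{1..n}. y (i k) * y (j k) \<ge> (y (m + k))\<^sup>2))))"

text \<open>
  The minimum size is taken in \<^typ>\<open>enat\<close>, so that it would be \<open>\<infinity>\<close> if no representation
  existed; a finite upper bound on it therefore includes the existence of a representation.
\<close>

definition min_soc_size :: "nat \<Rightarrow> (nat \<Rightarrow> nat) \<Rightarrow> enat" where
  "min_soc_size m s = Inf {enat n | n. \<exists>i j. simple_soc_representation m s n i j}"

end

theory Submission
  imports Defs
begin

text \<open>
  The bound comes from splitting the inequality into weighted mean inequalities of two variables.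
  Write \<open>S\<^sub>i = s\<^bsub>\<sigma>(i)\<^esub> + \<dots> + s\<^bsub>\<sigma>(m)\<^esub>\<close>. For nonnegative reals, the inequality
  \<open>z^S\<^sub>1 \<le> x\<^bsub>\<sigma>(1)\<^esub>^s\<^bsub>\<sigma>(1)\<^esub> \<cdots> x\<^bsub>\<sigma>(m)\<^esub>^s\<^bsub>\<sigma>(m)\<^esub>\<close> holds iff some \<open>\<tau> \<ge> 0\<close> satisfies
  \<open>z^S\<^sub>1 \<le> x\<^bsub>\<sigma>(1)\<^esub>^s\<^bsub>\<sigma>(1)\<^esub> \<tau>^S\<^sub>2\<close> together with the inequality of the same kind for \<open>\<tau>\<close> and
  the remaining \<open>m - 1\<close> factors. Iterating, only \<open>m - 1\<close> inequalities
  \<open>z^(a+b) \<le> u^a v^b\<close> remain, and each of them is to be expressed by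
  \<open>\<lceil>log\<^sub>2 ((a+b)/gcd(a+b,a))\<rceil>\<close> quadratic inequalities (lemma \<open>expressible_two\<close>).

  For this, divide the exponents by their greatest common divisor and multiply both sides by a
  power of \<open>z\<close>, so that the exponent on the left becomes the next power of two. This leaves
  \<open>z^(2^k) \<le> u^p v^q w^r\<close> with \<open>p + q + r = 2^k\<close> and not all of \<open>p, q, r\<close> even
  (lemma \<open>expressible_three\<close>). By parity exactly two exponents are odd, say
  \<open>p \<le> q\<close>. Pairing \<open>p\<close> copies of \<open>u\<close> with \<open>p\<close> copies of \<open>v\<close> and putting \<open>\<tau>\<^sup>2 \<le> u v\<close>
  turns the right side into \<open>\<tau>^(2p) v^(q-p) w^r\<close>; all exponents are now even, and a square root
  gives the same problem for \<open>k - 1\<close>, at the cost of one quadratic inequality. The exponents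
  \<open>p, (q-p)/2, r/2\<close> are again not all even because \<open>p\<close> is odd. At \<open>k = 1\<close> what is left is
  \<open>z\<^sup>2 \<le> u v\<close>, so \<open>k\<close> quadratic inequalities suffice.

  Both reductions eliminate one auxiliary variable \<open>\<tau>\<close> that is the target of one further block
  of quadratic inequalities. Lemma \<open>expressible_compose\<close> does the bookkeeping for both.
\<close>

section \<open>Systems of quadratic inequalities\<close>

definition soc_system :: "(nat \<Rightarrow> nat) \<Rightarrow> (nat \<Rightarrow> nat) \<Rightarrow> nat set \<Rightarrow> (nat \<Rightarrow> real) \<Rightarrow> bool" where
  "soc_system i j C y \<longleftrightarrow> (\<forall>c\<in>C. (y c)\<^sup>2 \<le> y (i c) * y (j c))"

text \<open>
  A condition \<open>P\<close> on the variables is expressed by \<open>n\<close> quadratic inequalities whose right sides are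
  the squares of the consecutive variables \<open>b, \<dots>, b + n - 1\<close>. The variable \<open>b\<close> belongs to the
  given point and the others are auxiliary. The factors may be taken from \<open>A\<close> (which is meant to
  contain \<open>b\<close>) and the auxiliary variables. In contrast to
  \<^const>\<open>simple_soc_representation\<close>, inequalities are indexed by their target, and points
  are nonnegative on all indices, so that blocks can be placed next to each other.
\<close>

definition expressible :: "nat \<Rightarrow> nat \<Rightarrow> nat set \<Rightarrow> ((nat \<Rightarrow> real) \<Rightarrow> bool) \<Rightarrow> bool" where
  "expressible b n A P \<longleftrightarrow> (\<exists>i j.
     (\<forall>c\<in>{b..<b + n}. i c \<in> A \<union> {b<..<b + n} \<and> j c \<in> A \<union> {b<..<b + n}) \<and>
     (\<forall>y. (\<forall>l. 0 \<le> y l) \<longrightarrow>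
        (P y \<longleftrightarrow> (\<exists>y'. (\<forall>l. 0 \<le> y' l) \<and> (\<forall>l. l \<notin> {b<..<b + n} \<longrightarrow> y' l = y l) \<and>
           soc_system i j {b..<b + n} y'))))"

lemma expressible_cong:
  assumes "expressible b n A P" and "\<And>y. (\<And>l. 0 \<le> y l) \<Longrightarrow> P y \<longleftrightarrow> Q y"
  shows "expressible b n A Q"
proof -
  have "((\<forall>l. 0 \<le> y l) \<longrightarrow> (P y \<longleftrightarrow> R)) \<longleftrightarrow> ((\<forall>l. 0 \<le> y l) \<longrightarrow> (Q y \<longleftrightarrow> R))" for y R
    using assms(2) by blast
  then show ?thesis
    using assms(1) unfolding expressible_def by (simp only:)
qed

lemma expressible_quadratic:
  assumes "u \<in> A" "v \<in> A"
  shows "expressible b 1 A (\<lambda>y. (y b)\<^sup>2 \<le> y u * y v)"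
proof -
  have "{b<..<b + 1} = {}" "{b..<b + 1} = {b}" by auto
  moreover have "(\<forall>l. y' l = y l) \<longleftrightarrow> y' = y" for y y' :: "nat \<Rightarrow> real" by auto
  ultimately show ?thesis
    unfolding expressible_def soc_system_def
    using assms by (intro exI[of _ "\<lambda>_. u"] exI[of _ "\<lambda>_. v"]) simp
qed

lemma soc_system_cong:
  assumes "soc_system i j C y"
    and "\<And>c. c \<in> C \<Longrightarrow> i c \<in> D \<and> j c \<in> D" and "C \<subseteq> D" and "\<And>l. l \<in> D \<Longrightarrow> y' l = y l"
  shows "soc_system i j C y'"
  using assms unfolding soc_system_def by (metis subsetD)

text \<open>
  An auxiliary variable \<open>t\<close> of one block may be the target of a second block, which is placed
  directly behind the first one. As neither block refers to the auxiliary variables of the other,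
  solutions of the two can be merged.
\<close>

lemma expressible_compose:
  assumes P: "expressible b n (insert t A) P" and Q: "expressible t n' (insert t A) Q"
    and t: "t = b + n" and "n \<ge> 1" "n' \<ge> 1"
    and b: "b \<in> A" and disj: "A \<inter> {b<..<b + (n + n')} = {}"
  shows "expressible b (n + n') A (\<lambda>y. \<exists>\<tau>\<ge>0. P (y(t := \<tau>)) \<and> Q (y(t := \<tau>)))"
proof -
  let ?F = "{b<..<b + n}" and ?G = "{t<..<t + n'}" and ?H = "{b<..<b + (n + n')}"
  obtain i1 j1 where ij1:
      "\<And>c. c \<in> {b..<b + n} \<Longrightarrow> i1 c \<in> insert t A \<union> ?F \<and> j1 c \<in> insert t A \<union> ?F"
    and P_iff: "\<And>y. (\<And>l. 0 \<le> y l) \<Longrightarrow> P y \<longleftrightarrow> (\<exists>y'. (\<forall>l. 0 \<le> y' l) \<and>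
        (\<forall>l. l \<notin> ?F \<longrightarrow> y' l = y l) \<and> soc_system i1 j1 {b..<b + n} y')"
    using P unfolding expressible_def by blast
  obtain i2 j2 where ij2:
      "\<And>c. c \<in> {t..<t + n'} \<Longrightarrow> i2 c \<in> insert t A \<union> ?G \<and> j2 c \<in> insert t A \<union> ?G"
    and Q_iff: "\<And>y. (\<And>l. 0 \<le> y l) \<Longrightarrow> Q y \<longleftrightarrow> (\<exists>y'. (\<forall>l. 0 \<le> y' l) \<and>
        (\<forall>l. l \<notin> ?G \<longrightarrow> y' l = y l) \<and> soc_system i2 j2 {t..<t + n'} y')"
    using Q unfolding expressible_def by blast
  have H: "?H = insert t (?F \<union> ?G)"
    using t \<open>n \<ge> 1\<close> \<open>n' \<ge> 1\<close> by auto
  have FG: "?F \<inter> ?G = {}" "t \<notin> ?F" "t \<notin> ?G"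
    using t by auto
  have A: "A \<inter> ?F = {}" "A \<inter> ?G = {}" "t \<notin> A"
    using disj unfolding H by auto
  have sub1: "{b..<b + n} \<subseteq> insert t A \<union> ?F" and sub2: "{t..<t + n'} \<subseteq> insert t A \<union> ?G"
    using b by auto
  define i j where "i = (\<lambda>c. if c < t then i1 c else i2 c)"
    and "j = (\<lambda>c. if c < t then j1 c else j2 c)"
  have sys: "soc_system i j {b..<b + (n + n')} y \<longleftrightarrow>
      soc_system i1 j1 {b..<b + n} y \<and> soc_system i2 j2 {t..<t + n'} y" for y
  proof -
    have "{b..<b + (n + n')} = {b..<b + n} \<union> {t..<t + n'}"
      using t by auto
    then show ?thesis
      unfolding soc_system_def i_def j_def using t by (simp add: ball_Un)
  qed
  have "i c \<in> A \<union> ?H \<and> j c \<in> A \<union> ?H" if "c \<in> {b..<b + (n + n')}" for c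
  proof (cases "c < t")
    case True
    then show ?thesis
      using ij1[of c] that t unfolding H i_def j_def by auto
  next
    case False
    then show ?thesis
      using ij2[of c] that t unfolding H i_def j_def by auto
  qed
  moreover have "(\<exists>\<tau>\<ge>0. P (y(t := \<tau>)) \<and> Q (y(t := \<tau>))) \<longleftrightarrow>
      (\<exists>y'. (\<forall>l. 0 \<le> y' l) \<and> (\<forall>l. l \<notin> ?H \<longrightarrow> y' l = y l) \<and>
        soc_system i j {b..<b + (n + n')} y')" (is "?L \<longleftrightarrow> ?R")
    if y: "\<forall>l. 0 \<le> y l" for y
  proof
    assume ?L
    then obtain \<tau> where \<tau>: "\<tau> \<ge> 0" "P (y(t := \<tau>))" "Q (y(t := \<tau>))"
      by blast
    have nn: "0 \<le> (y(t := \<tau>)) l" for l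
      using y \<tau>(1) by simp
    obtain y1 where y1: "\<And>l. 0 \<le> y1 l" "\<And>l. l \<notin> ?F \<Longrightarrow> y1 l = (y(t := \<tau>)) l"
      "soc_system i1 j1 {b..<b + n} y1"
      using iffD1[OF P_iff[of "y(t := \<tau>)", OF nn] \<tau>(2)] by blast
    obtain y2 where y2: "\<And>l. 0 \<le> y2 l" "\<And>l. l \<notin> ?G \<Longrightarrow> y2 l = (y(t := \<tau>)) l"
      "soc_system i2 j2 {t..<t + n'} y2"
      using iffD1[OF Q_iff[of "y(t := \<tau>)", OF nn] \<tau>(3)] by blast
    define y' where "y' = (\<lambda>l. if l \<in> ?F then y1 l else y2 l)"
    have "soc_system i1 j1 {b..<b + n} y'"
    proof (rule soc_system_cong[OF y1(3) ij1 sub1])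
      fix l assume "l \<in> insert t A \<union> ?F"
      then have "l \<in> ?F \<or> l \<notin> ?F \<and> l \<notin> ?G"
        using FG A by blast
      then show "y' l = y1 l"
        using y1(2)[of l] y2(2)[of l] unfolding y'_def by auto
    qed
    moreover have "soc_system i2 j2 {t..<t + n'} y'"
    proof (rule soc_system_cong[OF y2(3) ij2 sub2])
      fix l assume "l \<in> insert t A \<union> ?G"
      then have "l \<notin> ?F"
        using FG A by blast
      then show "y' l = y2 l"
        unfolding y'_def by auto
    qed
    moreover have "\<forall>l. 0 \<le> y' l"
      using y1(1) y2(1) unfolding y'_def by simp
    moreover have "y' l = y l" if "l \<notin> ?H" for l
    proof -
      have "l \<notin> ?F" "l \<notin> ?G" "l \<noteq> t"
        using that H by blast+
      then show ?thesis
        using y2(2)[of l] unfolding y'_def by auto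
    qed
    ultimately show ?R
      using sys by blast
  next
    assume ?R
    then obtain y' where y': "\<And>l. 0 \<le> y' l" "\<And>l. l \<notin> ?H \<Longrightarrow> y' l = y l"
      "soc_system i1 j1 {b..<b + n} y'" "soc_system i2 j2 {t..<t + n'} y'"
      using sys by blast
    let ?y = "y(t := y' t)"
    have nn: "0 \<le> ?y l" for l
      using y y'(1) by simp
    have on_A: "?y l = y' l" if "l \<in> insert t A" for l
    proof (cases "l = t")
      case False
      then have "l \<notin> ?H" using that disj by blast
      then show ?thesis using False y'(2)[of l] by simp
    qed simp
    have "soc_system i1 j1 {b..<b + n} (\<lambda>l. if l \<in> ?F then y' l else ?y l)"
      by (rule soc_system_cong[OF y'(3) ij1 sub1], assumption)
        (elim UnE; simp add: on_A del: fun_upd_apply insert_iff)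
    then have "P ?y"
      using nn y'(1)
      by (intro iffD2[OF P_iff[of ?y, OF nn]] exI[of _ "\<lambda>l. if l \<in> ?F then y' l else ?y l"]) simp
    moreover have "soc_system i2 j2 {t..<t + n'} (\<lambda>l. if l \<in> ?G then y' l else ?y l)"
      by (rule soc_system_cong[OF y'(4) ij2 sub2], assumption)
        (elim UnE; simp add: on_A del: fun_upd_apply insert_iff)
    then have "Q ?y"
      using nn y'(1)
      by (intro iffD2[OF Q_iff[of ?y, OF nn]] exI[of _ "\<lambda>l. if l \<in> ?G then y' l else ?y l"]) simp
    ultimately show ?L
      using y'(1) by blast
  qed
  ultimately show ?thesis
    unfolding expressible_def by blast
qed

section \<open>Elimination of a variable from mean inequalities\<close>

text \<open>The square root of the product is the largest admissible \<open>\<tau>\<close>, and for it the two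
  right sides agree after squaring.\<close>

lemma pair_off_factors:
  fixes z u v w :: real
  assumes nonneg: "z \<ge> 0" "u \<ge> 0" "v \<ge> 0" "w \<ge> 0"
  shows "(\<exists>\<tau>\<ge>0. z ^ M \<le> \<tau> ^ p * v ^ q * w ^ r \<and> \<tau>\<^sup>2 \<le> u * v) \<longleftrightarrow>
    z ^ (2 * M) \<le> u ^ p * v ^ (p + 2 * q) * w ^ (2 * r)"
proof -
  have square: "(\<tau> ^ p * v ^ q * w ^ r)\<^sup>2 = (\<tau>\<^sup>2) ^ p * (v ^ (2 * q) * w ^ (2 * r))" for \<tau>
    by (simp add: power_mult_distrib power_mult [symmetric] mult.commute mult.left_commute)
  have paired: "(u * v) ^ p * (v ^ (2 * q) * w ^ (2 * r)) = u ^ p * v ^ (p + 2 * q) * w ^ (2 * r)"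
    by (simp add: power_mult_distrib power_add)
  have z: "z ^ (2 * M) = (z ^ M)\<^sup>2"
    by (simp add: power_mult [symmetric] mult.commute)
  show ?thesis
  proof
    assume "\<exists>\<tau>\<ge>0. z ^ M \<le> \<tau> ^ p * v ^ q * w ^ r \<and> \<tau>\<^sup>2 \<le> u * v"
    then obtain \<tau> where \<tau>: "\<tau> \<ge> 0" "z ^ M \<le> \<tau> ^ p * v ^ q * w ^ r" "\<tau>\<^sup>2 \<le> u * v"
      by blast
    have "(z ^ M)\<^sup>2 \<le> (\<tau> ^ p * v ^ q * w ^ r)\<^sup>2"
      using \<tau>(2) nonneg by (intro power_mono) auto
    also have "\<dots> \<le> (u * v) ^ p * (v ^ (2 * q) * w ^ (2 * r))"
      unfolding square using \<tau>(3) nonneg by (intro mult_right_mono power_mono) auto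
    finally show "z ^ (2 * M) \<le> u ^ p * v ^ (p + 2 * q) * w ^ (2 * r)"
      unfolding z paired .
  next
    assume "z ^ (2 * M) \<le> u ^ p * v ^ (p + 2 * q) * w ^ (2 * r)"
    moreover have "(sqrt (u * v))\<^sup>2 = u * v"
      using nonneg by simp
    ultimately have "(z ^ M)\<^sup>2 \<le> (sqrt (u * v) ^ p * v ^ q * w ^ r)\<^sup>2"
      unfolding z square by (simp only: paired)
    then have "z ^ M \<le> sqrt (u * v) ^ p * v ^ q * w ^ r"
      by (rule power2_le_imp_le) (use nonneg in simp)
    then show "\<exists>\<tau>\<ge>0. z ^ M \<le> \<tau> ^ p * v ^ q * w ^ r \<and> \<tau>\<^sup>2 \<le> u * v"
      using nonneg by (intro exI[of _ "sqrt (u * v)"]) simp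
  qed
qed

lemma eliminate_power:
  fixes z a R :: real
  assumes "a \<ge> 0" "R \<ge> 0" "N > 0"
  shows "(\<exists>\<tau>\<ge>0. z \<le> a * \<tau> ^ N \<and> \<tau> ^ N \<le> R) \<longleftrightarrow> z \<le> a * R"
proof
  assume "z \<le> a * R"
  then show "\<exists>\<tau>\<ge>0. z \<le> a * \<tau> ^ N \<and> \<tau> ^ N \<le> R"
    using assms by (intro exI[of _ "root N R"]) (simp add: real_root_pow_pos2)
next
  assume "\<exists>\<tau>\<ge>0. z \<le> a * \<tau> ^ N \<and> \<tau> ^ N \<le> R"
  then show "z \<le> a * R"
    using assms(1) by (meson mult_left_mono order_trans)
qed

section \<open>Mean inequalities of two and three variables\<close>

text \<open>
  Exactly two of the exponents are odd. Up to the order of the factors, the smaller one is \<open>p\<close>,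
  the other one is \<open>p + 2 * q\<close>, and the even one is \<open>2 * r\<close>.
\<close>

lemma expressible_three:
  assumes "k \<ge> 1" "p + q + r = 2 ^ k" "odd p \<or> odd q \<or> odd r"
    and "u \<in> A" "v \<in> A" "w \<in> A" "b \<in> A" "A \<inter> {b<..<b + k} = {}"
  shows "expressible b k A (\<lambda>y. y b ^ 2 ^ k \<le> y u ^ p * y v ^ q * y w ^ r)"
  using assms
proof (induction k arbitrary: p q r u v w A rule: nat_induct_at_least)
  case base
  \<comment> \<open>The exponents are 1, 1 and 0 in some order.\<close>
  have "p = 1 \<and> q = 1 \<and> r = 0 \<or> p = 1 \<and> q = 0 \<and> r = 1 \<or> p = 0 \<and> q = 1 \<and> r = 1"
    using base.prems(1,2) by (cases "p = 2 \<or> q = 2 \<or> r = 2") auto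
  then show ?case
    using expressible_quadratic[of u A v b] expressible_quadratic[of u A w b]
      expressible_quadratic[of v A w b] base.prems by auto
next
  case (Suc k)
  have ordered: "expressible b (Suc k) A
      (\<lambda>y. y b ^ 2 ^ Suc k \<le> y u ^ p * y v ^ (p + 2 * q) * y w ^ (2 * r))"
    if sum: "p + (p + 2 * q) + 2 * r = 2 ^ Suc k" and "odd p" "u \<in> A" "v \<in> A" "w \<in> A"
    for p q r u v w
  proof -
    define t where "t = b + k"
    have t: "t \<notin> A"
      using Suc.prems(7) \<open>1 \<le> k\<close> unfolding t_def by auto
    then have neq: "b \<noteq> t" "u \<noteq> t" "v \<noteq> t" "w \<noteq> t"
      using that Suc.prems(6) by auto
    have "expressible b k (insert t A) (\<lambda>y. y b ^ 2 ^ k \<le> y t ^ p * y v ^ q * y w ^ r)"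
      by (rule Suc.IH) (use that Suc.prems(6,7) t_def in auto)
    moreover have "expressible t 1 (insert t A) (\<lambda>y. (y t)\<^sup>2 \<le> y u * y v)"
      using that by (intro expressible_quadratic) auto
    ultimately have "expressible b (k + 1) A (\<lambda>y. \<exists>\<tau>\<ge>0.
        y b ^ 2 ^ k \<le> \<tau> ^ p * y v ^ q * y w ^ r \<and> \<tau>\<^sup>2 \<le> y u * y v)"
      using expressible_compose[OF _ _ t_def] Suc.prems(6,7) \<open>1 \<le> k\<close> neq by fastforce
    then show ?thesis
      unfolding Suc_eq_plus1[symmetric] by (rule expressible_cong) (simp add: pair_off_factors)
  qed
  have two_odd: "expressible b (Suc k) A (\<lambda>y. y b ^ 2 ^ Suc k \<le> y u ^ p * y v ^ q * y w ^ r)"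
    if "p + q + r = 2 ^ Suc k" "odd p" "odd q" "p \<le> q" "u \<in> A" "v \<in> A" "w \<in> A"
    for p q r u v w
  proof -
    have "even (q - p)"
      using that by simp
    then obtain d where "q - p = 2 * d" by blast
    then have d: "q = p + 2 * d"
      using \<open>p \<le> q\<close> by linarith
    have "even (p + q + r)"
      using that(1) by simp
    then have "even r"
      using that(2,3) by simp
    then obtain e where e: "r = 2 * e" by blast
    show ?thesis
      using ordered[of p d e u v w] that unfolding d e by blast
  qed
  have "even (p + q + r)"
    using Suc.prems(1) by simp
  then consider "odd p" "odd q" | "odd p" "odd r" | "odd q" "odd r"
    using Suc.prems(2) by auto
  then show ?case
  proof cases
    case 1
    then show ?thesis
      using two_odd[of p q r u v w] two_odd[of q p r v u w] Suc.prems
      by (cases "p \<le> q") (simp_all add: ac_simps)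
  next
    case 2
    then show ?thesis
      using two_odd[of p r q u w v] two_odd[of r p q w u v] Suc.prems
      by (cases "p \<le> r") (simp_all add: ac_simps)
  next
    case 3
    then show ?thesis
      using two_odd[of q r p v w u] two_odd[of r q p w v u] Suc.prems
      by (cases "q \<le> r") (simp_all add: ac_simps)
  qed
qed

definition two_factor_size :: "nat \<Rightarrow> nat \<Rightarrow> nat" where
  "two_factor_size S a = nat \<lceil>log 2 (real S / real (gcd S a))\<rceil>"

lemma two_factor_size_ge_1:
  assumes "a > 0" "a < S"
  shows "two_factor_size S a \<ge> 1"
proof -
  have "gcd S a < S"
    by (rule le_less_trans[OF gcd_le2_nat]) (use assms in auto)
  then have "log 2 (real S / real (gcd S a)) > 0"
    using assms by (simp add: divide_simps)
  then show ?thesis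
    unfolding two_factor_size_def by linarith
qed

text \<open>
  The exponents divided by their greatest common divisor are coprime, hence not both even, and
  a power of the target variable itself serves as the third factor.
\<close>

lemma expressible_two:
  assumes "a > 0" "a' > 0" and k: "k = two_factor_size (a + a') a"
    and "u \<in> A" "v \<in> A" "b \<in> A" "A \<inter> {b<..<b + k} = {}"
  shows "expressible b k A (\<lambda>y. y b ^ (a + a') \<le> y u ^ a * y v ^ a')"
proof -
  define g where "g = gcd a a'"
  have "g > 0"
    using \<open>a > 0\<close> unfolding g_def by simp
  obtain p q where pq: "a = p * g" "a' = q * g" "coprime p q"
    using gcd_coprime_exists[of a a'] \<open>g > 0\<close> unfolding g_def by auto
  have "gcd (a + a') a = g"
    unfolding g_def by (simp add: gcd.commute)
  then have ratio: "real (a + a') / real (gcd (a + a') a) = real (p + q)"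
    using \<open>g > 0\<close> pq by (simp add: field_simps)
  have "log 2 (real (p + q)) \<le> real k"
    unfolding k two_factor_size_def ratio by (rule real_nat_ceiling_ge)
  moreover have "p + q > 0"
    using pq \<open>a > 0\<close> by (cases p) auto
  ultimately have "real (p + q) \<le> 2 powr real k"
    by (simp add: log_le_iff)
  then have "real (p + q) \<le> real (2 ^ k)"
    by (simp add: powr_realpow)
  then have "p + q \<le> 2 ^ k"
    by (simp only: of_nat_le_iff)
  then obtain r where r: "p + q + r = 2 ^ k"
    by (metis le_Suc_ex)
  have "k \<ge> 1"
    unfolding k using assms by (intro two_factor_size_ge_1) auto
  moreover have "odd p \<or> odd q \<or> odd r"
    using pq(3) coprime_common_divisor_nat[of p q 2] by auto
  ultimately have "expressible b k A (\<lambda>y. y b ^ 2 ^ k \<le> y u ^ p * y v ^ q * y b ^ r)"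
    using assms r by (intro expressible_three) auto
  then show ?thesis
  proof (rule expressible_cong)
    fix y :: "nat \<Rightarrow> real" assume y: "\<And>l. 0 \<le> y l"
    have "y b ^ 2 ^ k \<le> y u ^ p * y v ^ q * y b ^ r \<longleftrightarrow> y b ^ (p + q) \<le> y u ^ p * y v ^ q"
    proof (cases "y b = 0")
      case True
      then show ?thesis
        using y \<open>p + q > 0\<close> by (simp only: power_0_left) simp
    next
      case False
      then have "y b ^ r > 0"
        using y[of b] by simp
      then show ?thesis
        unfolding r[symmetric] power_add[of _ "p + q" r] by simp
    qed
    also have "\<dots> \<longleftrightarrow> (y b ^ (p + q)) ^ g \<le> (y u ^ p * y v ^ q) ^ g"
      using y \<open>g > 0\<close> by (simp add: power_mono_iff)
    also have "\<dots> \<longleftrightarrow> y b ^ (a + a') \<le> y u ^ a * y v ^ a'"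
      unfolding pq by (simp add: power_mult_distrib add_mult_distrib flip: power_mult)
    finally show "y b ^ 2 ^ k \<le> y u ^ p * y v ^ q * y b ^ r \<longleftrightarrow>
        y b ^ (a + a') \<le> y u ^ a * y v ^ a'" .
  qed
qed

section \<open>Mean inequalities of several variables\<close>

text \<open>
  The factors are split off one by one from the front: the target of the block for the factors
  from \<open>i + 1\<close> on is an auxiliary variable standing for their weighted mean.
\<close>

lemma expressible_weighted_mean:
  fixes a x :: "nat \<Rightarrow> nat" and m :: nat
  defines "S \<equiv> \<lambda>i. \<Sum>j=i..m. a j"
  defines "N \<equiv> \<lambda>i. \<Sum>l=i..m - 1. two_factor_size (S l) (a l)"
  assumes "1 \<le> i" "i \<le> m - 1" and pos: "\<And>j. j \<in> {1..m} \<Longrightarrow> a j > 0"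
    and "x ` {i..m} \<subseteq> A" "b \<in> A" "A \<inter> {b<..<b + N i} = {}"
  shows "expressible b (N i) A (\<lambda>y. y b ^ S i \<le> (\<Prod>j=i..m. y (x j) ^ a j))"
  using \<open>i \<le> m - 1\<close> assms(6-8)
proof (induction i arbitrary: A b rule: inc_induct)
  case base
  have m: "{m - 1..m} = {m - 1, m}" "m - 1 \<noteq> m"
    using \<open>1 \<le> i\<close> \<open>i \<le> m - 1\<close> by auto
  have S: "S (m - 1) = a (m - 1) + a m"
    unfolding S_def m(1) using m(2) by simp
  then have "N (m - 1) = two_factor_size (a (m - 1) + a m) (a (m - 1))"
    unfolding N_def by simp
  then have "expressible b (N (m - 1)) A
      (\<lambda>y. y b ^ (a (m - 1) + a m) \<le> y (x (m - 1)) ^ a (m - 1) * y (x m) ^ a m)"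
    using base.prems \<open>1 \<le> i\<close> \<open>i \<le> m - 1\<close> m by (intro expressible_two pos) auto
  then show ?case
    unfolding S m(1) using m(2) by simp
next
  case (step n)
  have n: "1 \<le> n" "n < m - 1"
    using step.hyps \<open>1 \<le> i\<close> by auto
  define k where "k = two_factor_size (S n) (a n)"
  define t where "t = b + k"
  have split: "{n..m} = insert n {Suc n..m}" "{n..m - 1} = insert n {Suc n..m - 1}"
    using n by auto
  have S: "S n = a n + S (Suc n)" and N: "N n = k + N (Suc n)"
    unfolding N_def k_def split(2) by (simp_all add: S_def split(1))
  have S_pos: "S l > 0" if "1 \<le> l" "l \<le> m" for l
    unfolding S_def using pos that by (intro sum_pos) auto
  have "k \<ge> 1"
    unfolding k_def using n pos S_pos[of "Suc n"] S by (intro two_factor_size_ge_1) auto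
  have "S (Suc n) = a (Suc n) + S (Suc (Suc n))"
    unfolding S_def using n by (subst sum.atLeast_Suc_atMost) auto
  then have "two_factor_size (S (Suc n)) (a (Suc n)) \<ge> 1"
    using n pos S_pos[of "Suc (Suc n)"] by (intro two_factor_size_ge_1) auto
  also have "two_factor_size (S (Suc n)) (a (Suc n)) \<le> N (Suc n)"
    unfolding N_def using n by (intro member_le_sum) auto
  finally have "N (Suc n) \<ge> 1" .
  have t: "t \<notin> A"
    using step.prems(3) \<open>k \<ge> 1\<close> \<open>N (Suc n) \<ge> 1\<close> unfolding t_def N by auto
  have neq: "b \<noteq> t" and x_neq: "\<And>j. j \<in> {n..m} \<Longrightarrow> x j \<noteq> t"
    using t step.prems(1,2) by blast+
  have "expressible b k (insert t A) (\<lambda>y. y b ^ (a n + S (Suc n)) \<le> y (x n) ^ a n * y t ^ S (Suc n))"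
  proof (rule expressible_two)
    show "k = two_factor_size (a n + S (Suc n)) (a n)"
      unfolding k_def S ..
    show "insert t A \<inter> {b<..<b + k} = {}"
      using step.prems(3) unfolding t_def N by auto
  qed (use step.prems n pos S_pos[of "Suc n"] in \<open>auto simp: image_subset_iff\<close>)
  moreover have "expressible t (N (Suc n)) (insert t A)
      (\<lambda>y. y t ^ S (Suc n) \<le> (\<Prod>j=Suc n..m. y (x j) ^ a j))"
  proof (rule step.IH)
    show "insert t A \<inter> {t<..<t + N (Suc n)} = {}"
      using step.prems(3) unfolding t_def N by auto
  qed (use step.prems split in auto)
  ultimately have "expressible b (k + N (Suc n)) A (\<lambda>y. \<exists>\<tau>\<ge>0.
      (y(t := \<tau>)) b ^ (a n + S (Suc n)) \<le> (y(t := \<tau>)) (x n) ^ a n * (y(t := \<tau>)) t ^ S (Suc n) \<and>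
      (y(t := \<tau>)) t ^ S (Suc n) \<le> (\<Prod>j=Suc n..m. (y(t := \<tau>)) (x j) ^ a j))"
    by (rule expressible_compose)
      (use t_def \<open>k \<ge> 1\<close> \<open>N (Suc n) \<ge> 1\<close> step.prems N in auto)
  then show ?case
    unfolding N
  proof (rule expressible_cong)
    fix y :: "nat \<Rightarrow> real" assume y: "\<And>l. 0 \<le> y l"
    have "(\<Prod>j=Suc n..m. (y(t := \<tau>)) (x j) ^ a j) = (\<Prod>j=Suc n..m. y (x j) ^ a j)" for \<tau>
      using x_neq n by (intro prod.cong) auto
    moreover have "(\<Prod>j=n..m. y (x j) ^ a j) = y (x n) ^ a n * (\<Prod>j=Suc n..m. y (x j) ^ a j)"
      by (simp add: split)
    moreover have "(\<Prod>j=Suc n..m. y (x j) ^ a j) \<ge> 0"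
      using y by (intro prod_nonneg) auto
    ultimately show "(\<exists>\<tau>\<ge>0.
      (y(t := \<tau>)) b ^ (a n + S (Suc n)) \<le> (y(t := \<tau>)) (x n) ^ a n * (y(t := \<tau>)) t ^ S (Suc n) \<and>
      (y(t := \<tau>)) t ^ S (Suc n) \<le> (\<Prod>j=Suc n..m. (y(t := \<tau>)) (x j) ^ a j)) \<longleftrightarrow>
      y b ^ S n \<le> (\<Prod>j=n..m. y (x j) ^ a j)"
      using y neq x_neq[of n] n S_pos[of "Suc n"] by (simp add: S eliminate_power)
  qed
qed

section \<open>The bound on the minimum size\<close>

lemma simple_soc_representation_if_expressible:
  assumes E: "expressible (m + 1) n {1..m + 1} (weighted_gm_ineq m s)" and "n \<ge> 1"
  shows "\<exists>i j. simple_soc_representation m s n i j"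
proof -
  let ?F = "{m + 1<..<m + 1 + n}"
  obtain i j where ij:
      "\<And>c. c \<in> {m + 1..<m + 1 + n} \<Longrightarrow> i c \<in> {1..m + 1} \<union> ?F \<and> j c \<in> {1..m + 1} \<union> ?F"
    and iff: "\<And>y. (\<And>l. 0 \<le> y l) \<Longrightarrow> weighted_gm_ineq m s y \<longleftrightarrow> (\<exists>y'. (\<forall>l. 0 \<le> y' l) \<and>
        (\<forall>l. l \<notin> ?F \<longrightarrow> y' l = y l) \<and> soc_system i j {m + 1..<m + 1 + n} y')"
    using E unfolding expressible_def by blast
  have U: "{1..m + 1} \<union> ?F = {1..m + n}"
    using \<open>n \<ge> 1\<close> by auto
  have sys: "soc_system i j {m + 1..<m + 1 + n} y \<longleftrightarrow>
      (\<forall>k\<in>{1..n}. y (i (m + k)) * y (j (m + k)) \<ge> (y (m + k))\<^sup>2)" for y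
  proof -
    have "{m + 1..<m + 1 + n} = (+) m ` {1..n}"
      by (simp add: image_add_atLeastAtMost atLeastLessThanSuc_atLeastAtMost add.commute)
    then show ?thesis
      unfolding soc_system_def by (simp only: ball_simps)
  qed
  have "weighted_gm_ineq m s x \<longleftrightarrow> (\<exists>y. (\<forall>l\<in>{1..m + 1}. y l = x l) \<and>
      (\<forall>l\<in>{m + 2..m + n}. 0 \<le> y l) \<and> soc_system i j {m + 1..<m + 1 + n} y)" (is "_ \<longleftrightarrow> ?R")
    if x: "\<forall>l\<in>{1..m + 1}. 0 \<le> x l" for x
  proof -
    \<comment> \<open>Indices beyond the given point get the value 0, to make the point nonnegative everywhere.\<close>
    define z where "z = (\<lambda>l. if l \<in> {1..m + 1} then x l else 0)"
    have z: "0 \<le> z l" for l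
      using x unfolding z_def by simp
    have "(\<Prod>l=1..m. z l ^ s l) = (\<Prod>l=1..m. x l ^ s l)"
      unfolding z_def by (intro prod.cong) auto
    then have "weighted_gm_ineq m s x \<longleftrightarrow> weighted_gm_ineq m s z"
      unfolding weighted_gm_ineq_def by (simp add: z_def)
    also have "\<dots> \<longleftrightarrow> ?R"
    proof
      assume "weighted_gm_ineq m s z"
      then obtain y where "\<And>l. 0 \<le> y l" "\<And>l. l \<notin> ?F \<Longrightarrow> y l = z l"
        "soc_system i j {m + 1..<m + 1 + n} y"
        using iff[of z, OF z] by blast
      then show ?R
        by (intro exI[of _ y]) (simp add: z_def)
    next
      assume ?R
      then obtain y where y: "\<forall>l\<in>{1..m + 1}. y l = x l" "\<forall>l\<in>{m + 2..m + n}. 0 \<le> y l"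
        "soc_system i j {m + 1..<m + 1 + n} y"
        by blast
      define y' where "y' = (\<lambda>l. if l \<in> {1..m + n} then y l else 0)"
      have "soc_system i j {m + 1..<m + 1 + n} y'"
        by (rule soc_system_cong[OF y(3) ij], unfold U) (auto simp: y'_def)
      moreover have "0 \<le> y' l" for l
      proof (cases "l \<in> {1..m + 1}")
        case True
        then show ?thesis using x y(1) unfolding y'_def by simp
      next
        case False
        then have "l \<in> {1..m + n} \<Longrightarrow> l \<in> {m + 2..m + n}" by auto
        then show ?thesis using y(2) unfolding y'_def by simp
      qed
      moreover have "y' l = z l" if "l \<notin> ?F" for l
      proof (cases "l \<in> {1..m + 1}")
        case True
        then have "l \<in> {1..m + n}" using \<open>n \<ge> 1\<close> by auto
        then show ?thesis using True y(1) unfolding y'_def z_def by simp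
      next
        case False
        then have "l \<notin> {1..m + n}" using that U by blast
        then show ?thesis using False unfolding y'_def z_def by auto
      qed
      ultimately show "weighted_gm_ineq m s z"
        using iff[of z, OF z] by blast
    qed
    finally show ?thesis .
  qed
  then have "simple_soc_representation m s n (\<lambda>k. i (m + k)) (\<lambda>k. j (m + k))"
    using \<open>n \<ge> 1\<close> ij unfolding simple_soc_representation_def sys U by simp
  then show ?thesis by blast
qed

lemma min_soc_size_le_permuted:
  assumes "m \<ge> 2" and pos: "\<And>i. i \<in> {1..m} \<Longrightarrow> s i > 0" and \<sigma>: "\<sigma> permutes {1..m}"
  shows "min_soc_size m s \<le>
    enat (\<Sum>i=1..m - 1. two_factor_size (\<Sum>j=i..m. s (\<sigma> j)) (s (\<sigma> i)))" (is "_ \<le> enat ?N")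
proof -
  have in_range: "\<sigma> j \<in> {1..m}" if "j \<in> {1..m}" for j
    using permutes_in_image[OF \<sigma>] that by blast
  have pos': "s (\<sigma> j) > 0" if "j \<in> {1..m}" for j
    using pos in_range that by blast
  have "expressible (m + 1) ?N {1..m + 1}
      (\<lambda>y. y (m + 1) ^ (\<Sum>j=1..m. s (\<sigma> j)) \<le> (\<Prod>j=1..m. y (\<sigma> j) ^ s (\<sigma> j)))"
    by (rule expressible_weighted_mean) (use \<open>m \<ge> 2\<close> pos' in_range in force)+
  then have "expressible (m + 1) ?N {1..m + 1} (weighted_gm_ineq m s)"
  proof (rule expressible_cong)
    fix y :: "nat \<Rightarrow> real"
    show "y (m + 1) ^ (\<Sum>j=1..m. s (\<sigma> j)) \<le> (\<Prod>j=1..m. y (\<sigma> j) ^ s (\<sigma> j)) \<longleftrightarrow>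
        weighted_gm_ineq m s y"
      unfolding weighted_gm_ineq_def
      using sum.permute[OF \<sigma>, of s] prod.permute[OF \<sigma>, of "\<lambda>l. y l ^ s l"] by (simp add: o_def)
  qed
  moreover have "?N \<ge> 1"
  proof -
    have "(\<Sum>j=1..m. s (\<sigma> j)) = s (\<sigma> 1) + (\<Sum>j=2..m. s (\<sigma> j))"
      using \<open>m \<ge> 2\<close> by (subst sum.atLeast_Suc_atMost) (auto simp: numeral_2_eq_2)
    moreover have "(\<Sum>j=2..m. s (\<sigma> j)) > 0"
      using pos' \<open>m \<ge> 2\<close> by (intro sum_pos) auto
    ultimately have "1 \<le> two_factor_size (\<Sum>j=1..m. s (\<sigma> j)) (s (\<sigma> 1))"
      using pos'[of 1] \<open>m \<ge> 2\<close> by (intro two_factor_size_ge_1) auto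
    also have "\<dots> \<le> ?N"
      using \<open>m \<ge> 2\<close>
        member_le_sum[of 1 "{1..m - 1}" "\<lambda>i. two_factor_size (\<Sum>j=i..m. s (\<sigma> j)) (s (\<sigma> i))"]
      by auto
    finally show ?thesis .
  qed
  ultimately have "\<exists>i j. simple_soc_representation m s ?N i j"
    by (rule simple_soc_representation_if_expressible)
  then show ?thesis
    unfolding min_soc_size_def by (intro Inf_lower) blast
qed

theorem corollary22:
  fixes m :: nat and s :: "nat \<Rightarrow> nat"
  assumes "m \<ge> 2"
    and "\<And>i. i \<in> {1..m} \<Longrightarrow> s i > 0"
    and "Gcd (s ` {1..m}) = 1"
  shows "min_soc_size m s \<le>
    enat (Min ((\<lambda>\<sigma>. \<Sum>i=1..m - 1.
        nat \<lceil>log 2 (real (\<Sum>j=i..m. s (\<sigma> j)) /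
                 real (gcd (\<Sum>j=i..m. s (\<sigma> j)) (s (\<sigma> i))))\<rceil>)
      ` {\<sigma>. \<sigma> permutes {1..m}}))"
    (is "_ \<le> enat (Min (?f ` ?P))")
proof -
  have "finite ?P"
    by (simp add: finite_permutations)
  moreover have "?P \<noteq> {}"
    using permutes_id by blast
  ultimately have "Min (?f ` ?P) \<in> ?f ` ?P"
    by (intro Min_in) simp_all
  then obtain \<sigma> where \<sigma>: "\<sigma> permutes {1..m}" and min: "Min (?f ` ?P) = ?f \<sigma>"
    by blast
  show ?thesis
    unfolding min using min_soc_size_le_permuted[OF assms(1,2) \<sigma>]
    by (simp only: two_factor_size_def)
qed

end
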